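(* There is a unique homomorphism $\varphi:\mathbf{SB}(S_n)\to\mathbf{IS}_n$ such that $$\varphi(\sigma_{s_i})=s_i\quad\text{and}\quad\varphi(\tau_{s_i})=\varepsilon_{\{i,i+1\}},\qquad\text{for } i=1,2,\dots,n-1.$$ The image of $\varphi$ coincides with $\widetilde{\mathbf{IS}}_n$.
   Context: The singular Artin monoid $\mathbf{SB}(S_n)$ of type $A_{n-1}$ (the singular braid monoid on $n$ strands) is the monoid generated by invertible elements $\sigma_i=\sigma_{s_i}$ and elements $\tau_i=\tau_{s_i}$, $1\le i\le n-1$, subject to: $\sigma_i\sigma_j\sigma_i=\sigma_j\sigma_i\sigma_j$ and $\tau_i\sigma_j\sigma_i=\sigma_j\sigma_i\tau_j$ for $|i-j|=1$; $\sigma_i\sigma_j=\sigma_j\sigma_i$, $\tau_i\sigma_j=\sigma_j\tau_i$ and $\tau_i\tau_j=\tau_j\tau_i$ for $|i-j|>1$; and $\tau_i\sigma_i=\sigma_i\tau_i$ for all $i$. Let $\underline{n}=\{1,\dots,n\}$. $\mathbf{IS}_n$ is the symmetric inverse monoid of all bijections between subsets of $\underline{n}$, under composition of partial maps; its group of units is $S_n$, and $s_i=(i,i+1)$. The rank of an element is the cardinality of its domain, and $\widetilde{\mathbf{IS}}_n$ is the submonoid of all elements whose rank is different from $n-1$. For $Y\subset\underline n$, $\varepsilon_Y$ denotes the identity map on $\underline n\setminus Y$. *)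

theory Defs
  imports "HOL-Algebra.Group" "HOL-Combinatorics.Transposition"
begin

section \<open>Monoid presentations\<close>

inductive_set monoid_cong :: "'a set \<Rightarrow> ('a list \<times> 'a list) set \<Rightarrow> ('a list \<times> 'a list) set"
  for A R where
  base: "(u, v) \<in> R \<Longrightarrow> u \<in> lists A \<Longrightarrow> v \<in> lists A \<Longrightarrow> (u, v) \<in> monoid_cong A R"
| refl: "u \<in> lists A \<Longrightarrow> (u, u) \<in> monoid_cong A R"
| sym: "(u, v) \<in> monoid_cong A R \<Longrightarrow> (v, u) \<in> monoid_cong A R"
| trans: "(u, v) \<in> monoid_cong A R \<Longrightarrow> (v, w) \<in> monoid_cong A R \<Longrightarrow> (u, w) \<in> monoid_cong A R"
| mult: "(u, v) \<in> monoid_cong A R \<Longrightarrow> (u', v') \<in> monoid_cong A R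
    \<Longrightarrow> (u @ u', v @ v') \<in> monoid_cong A R"

definition word_class :: "'a set \<Rightarrow> ('a list \<times> 'a list) set \<Rightarrow> 'a list \<Rightarrow> 'a list set" where
  "word_class A R w = monoid_cong A R `` {w}"

definition presented_monoid :: "'a set \<Rightarrow> ('a list \<times> 'a list) set \<Rightarrow> 'a list set monoid" where
  "presented_monoid A R =
     \<lparr>carrier = lists A // monoid_cong A R,
      mult = (\<lambda>X Y. \<Union>u\<in>X. \<Union>v\<in>Y. word_class A R (u @ v)),
      one = word_class A R []\<rparr>"

lemma monoid_cong_lists: "(u, v) \<in> monoid_cong A R \<Longrightarrow> u \<in> lists A \<and> v \<in> lists A"
  by (induction rule: monoid_cong.induct) auto

lemma equiv_monoid_cong: "equiv (lists A) (monoid_cong A R)"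
proof (rule equivI)
  show "monoid_cong A R \<subseteq> lists A \<times> lists A"
    using monoid_cong_lists by fast
  show "refl_on (lists A) (monoid_cong A R)"
    by (rule refl_onI) (rule monoid_cong.refl)
  show "sym (monoid_cong A R)"
    by (rule symI) (rule monoid_cong.sym)
  show "trans (monoid_cong A R)"
    by (rule transI) (rule monoid_cong.trans)
qed

lemma word_class_eq_iff:
  assumes "u \<in> lists A" "v \<in> lists A"
  shows "word_class A R u = word_class A R v \<longleftrightarrow> (u, v) \<in> monoid_cong A R"
  unfolding word_class_def by (rule eq_equiv_class_iff[OF equiv_monoid_cong assms])

lemma carrier_presented_monoid:
  "carrier (presented_monoid A R) = word_class A R ` lists A"
  by (auto simp: presented_monoid_def quotient_def word_class_def)

lemma one_presented_monoid: "\<one>\<^bsub>presented_monoid A R\<^esub> = word_class A R []"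
  by (simp add: presented_monoid_def)

lemma mult_presented_monoid:
  assumes "u \<in> lists A" "v \<in> lists A"
  shows "word_class A R u \<otimes>\<^bsub>presented_monoid A R\<^esub> word_class A R v = word_class A R (u @ v)"
proof -
  have "word_class A R (u' @ v') = word_class A R (u @ v)"
    if "u' \<in> word_class A R u" "v' \<in> word_class A R v" for u' v'
  proof -
    have "(u @ v, u' @ v') \<in> monoid_cong A R"
      using that by (auto simp: word_class_def intro: monoid_cong.mult)
    then show ?thesis
      unfolding word_class_def by (rule equiv_class_eq[OF equiv_monoid_cong, symmetric])
  qed
  moreover have "u \<in> word_class A R u" "v \<in> word_class A R v"
    using assms by (auto simp: word_class_def intro: monoid_cong.refl)
  ultimately have "(\<Union>u'\<in>word_class A R u. \<Union>v'\<in>word_class A R v. word_class A R (u' @ v'))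
      = word_class A R (u @ v)"
    by blast
  then show ?thesis
    by (simp add: presented_monoid_def)
qed

lemma monoid_presented_monoid: "monoid (presented_monoid A R)"
proof -
  have append: "u @ v \<in> lists A" if "u \<in> lists A" "v \<in> lists A" for u v
    using that by simp
  show ?thesis
  proof (rule monoidI, unfold carrier_presented_monoid)
    show "\<one>\<^bsub>presented_monoid A R\<^esub> \<in> word_class A R ` lists A"
      by (simp add: one_presented_monoid)
  qed (elim imageE, simp only: one_presented_monoid mult_presented_monoid append
      lists.Nil append_Nil append_Nil2 append_assoc imageI)+
qed

text \<open>\<^const>\<open>hom\<close> only asks for preservation of products.\<close>

definition monoid_hom :: "('a, 'c) monoid_scheme \<Rightarrow> ('b, 'd) monoid_scheme \<Rightarrow> ('a \<Rightarrow> 'b) set" where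
  "monoid_hom G H = {h \<in> hom G H. h \<one>\<^bsub>G\<^esub> = \<one>\<^bsub>H\<^esub>}"


section \<open>The singular braid monoid\<close>

datatype sb_letter = Sig nat | SigInv nat | Tau nat

definition sb_letters :: "nat \<Rightarrow> sb_letter set" where
  "sb_letters n = Sig ` {1..<n} \<union> SigInv ` {1..<n} \<union> Tau ` {1..<n}"

inductive_set sb_relations :: "nat \<Rightarrow> (sb_letter list \<times> sb_letter list) set"
  for n where
  inv_right: "i \<in> {1..<n} \<Longrightarrow> ([Sig i, SigInv i], []) \<in> sb_relations n"
| inv_left: "i \<in> {1..<n} \<Longrightarrow> ([SigInv i, Sig i], []) \<in> sb_relations n"
| braid: "i \<in> {1..<n} \<Longrightarrow> j \<in> {1..<n} \<Longrightarrow> \<bar>int i - int j\<bar> = 1 \<Longrightarrow>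
    ([Sig i, Sig j, Sig i], [Sig j, Sig i, Sig j]) \<in> sb_relations n"
| mixed_braid: "i \<in> {1..<n} \<Longrightarrow> j \<in> {1..<n} \<Longrightarrow> \<bar>int i - int j\<bar> = 1 \<Longrightarrow>
    ([Tau i, Sig j, Sig i], [Sig j, Sig i, Tau j]) \<in> sb_relations n"
| comm_sig_sig: "i \<in> {1..<n} \<Longrightarrow> j \<in> {1..<n} \<Longrightarrow> \<bar>int i - int j\<bar> > 1 \<Longrightarrow>
    ([Sig i, Sig j], [Sig j, Sig i]) \<in> sb_relations n"
| comm_tau_sig: "i \<in> {1..<n} \<Longrightarrow> j \<in> {1..<n} \<Longrightarrow> \<bar>int i - int j\<bar> > 1 \<Longrightarrow>
    ([Tau i, Sig j], [Sig j, Tau i]) \<in> sb_relations n"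
| comm_tau_tau: "i \<in> {1..<n} \<Longrightarrow> j \<in> {1..<n} \<Longrightarrow> \<bar>int i - int j\<bar> > 1 \<Longrightarrow>
    ([Tau i, Tau j], [Tau j, Tau i]) \<in> sb_relations n"
| comm_same: "i \<in> {1..<n} \<Longrightarrow> ([Tau i, Sig i], [Sig i, Tau i]) \<in> sb_relations n"

definition SB :: "nat \<Rightarrow> sb_letter list set monoid" where
  "SB n = presented_monoid (sb_letters n) (sb_relations n)"

definition sigma :: "nat \<Rightarrow> nat \<Rightarrow> sb_letter list set" where
  "sigma n i = word_class (sb_letters n) (sb_relations n) [Sig i]"

definition tau :: "nat \<Rightarrow> nat \<Rightarrow> sb_letter list set" where
  "tau n i = word_class (sb_letters n) (sb_relations n) [Tau i]"

lemma monoid_SB: "monoid (SB n)"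
  unfolding SB_def by (rule monoid_presented_monoid)

lemma sigma_Units:
  assumes i: "i \<in> {1..<n}"
  shows "sigma n i \<in> Units (SB n)"
proof -
  let ?c = "word_class (sb_letters n) (sb_relations n)"
  have l: "[Sig i] \<in> lists (sb_letters n)" "[SigInv i] \<in> lists (sb_letters n)"
    using i by (auto simp: sb_letters_def)
  have "([Sig i, SigInv i], []) \<in> monoid_cong (sb_letters n) (sb_relations n)"
    "([SigInv i, Sig i], []) \<in> monoid_cong (sb_letters n) (sb_relations n)"
    using l i by (auto intro!: monoid_cong.base sb_relations.inv_left sb_relations.inv_right)
  then have c: "?c [Sig i, SigInv i] = ?c []" "?c [SigInv i, Sig i] = ?c []"
    using l by (simp_all add: word_class_eq_iff)
  have "?c [Sig i] \<otimes>\<^bsub>SB n\<^esub> ?c [SigInv i] = \<one>\<^bsub>SB n\<^esub>"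
    "?c [SigInv i] \<otimes>\<^bsub>SB n\<^esub> ?c [Sig i] = \<one>\<^bsub>SB n\<^esub>"
    unfolding SB_def mult_presented_monoid[OF l] mult_presented_monoid[OF l(2) l(1)]
      one_presented_monoid using c by simp_all
  moreover have "?c [Sig i] \<in> carrier (SB n)" "?c [SigInv i] \<in> carrier (SB n)"
    unfolding SB_def carrier_presented_monoid using l by blast+
  ultimately show ?thesis
    unfolding Units_def sigma_def by blast
qed

lemma tau_carrier: "i \<in> {1..<n} \<Longrightarrow> tau n i \<in> carrier (SB n)"
  unfolding SB_def tau_def carrier_presented_monoid by (auto simp: sb_letters_def)


section \<open>The symmetric inverse monoid\<close>

text \<open>A bijection between subsets of \<open>{1..n}\<close> is encoded as a partial function on \<open>nat\<close>;
  in a product the right factor is applied first.\<close>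

definition IS :: "nat \<Rightarrow> (nat \<rightharpoonup> nat) monoid" where
  "IS n = \<lparr>carrier = {f. dom f \<subseteq> {1..n} \<and> ran f \<subseteq> {1..n} \<and> inj_on f (dom f)},
           mult = (\<lambda>f g. f \<circ>\<^sub>m g),
           one = Some |` {1..n}\<rparr>"

definition rank :: "(nat \<rightharpoonup> nat) \<Rightarrow> nat" where
  "rank f = card (dom f)"

definition IS_tilde :: "nat \<Rightarrow> (nat \<rightharpoonup> nat) set" where
  "IS_tilde n = {f \<in> carrier (IS n). rank f + 1 \<noteq> n}"

definition simple_transp :: "nat \<Rightarrow> nat \<Rightarrow> (nat \<rightharpoonup> nat)" where
  "simple_transp n i = (Some \<circ> transpose i (i + 1)) |` {1..n}"

definition eps :: "nat \<Rightarrow> nat set \<Rightarrow> (nat \<rightharpoonup> nat)" where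
  "eps n Y = Some |` ({1..n} - Y)"

lemma map_comp_carrier_IS:
  assumes "f \<in> carrier (IS n)" "g \<in> carrier (IS n)"
  shows "f \<circ>\<^sub>m g \<in> carrier (IS n)"
proof -
  have "dom (f \<circ>\<^sub>m g) \<subseteq> dom g" "ran (f \<circ>\<^sub>m g) \<subseteq> ran f"
    by (auto simp: map_comp_def ran_def split: option.splits)
  then have "dom (f \<circ>\<^sub>m g) \<subseteq> {1..n}" "ran (f \<circ>\<^sub>m g) \<subseteq> {1..n}"
    using assms unfolding IS_def partial_object.simps mem_Collect_eq by (meson subset_trans)+
  moreover have "inj_on (f \<circ>\<^sub>m g) (dom (f \<circ>\<^sub>m g))"
  proof (rule inj_onI)
    fix x y
    assume "x \<in> dom (f \<circ>\<^sub>m g)" and eq: "(f \<circ>\<^sub>m g) x = (f \<circ>\<^sub>m g) y"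
    then obtain c where "(f \<circ>\<^sub>m g) x = Some c" by blast
    with eq have "(f \<circ>\<^sub>m g) x = Some c" "(f \<circ>\<^sub>m g) y = Some c" by simp_all
    then obtain a b where ab: "g x = Some a" "g y = Some b" "f a = Some c" "f b = Some c"
      unfolding map_comp_Some_iff by blast
    have inj: "inj_on f (dom f)" "inj_on g (dom g)"
      using assms by (simp_all add: IS_def)
    have "a = b"
      using inj_onD[OF inj(1), of a b] ab by (simp add: domI)
    then show "x = y"
      using inj_onD[OF inj(2), of x y] ab by (simp add: domI)
  qed
  ultimately show ?thesis by (simp add: IS_def)
qed

lemma monoid_IS: "monoid (IS n)"
proof (rule monoidI)
  fix f g h assume f: "f \<in> carrier (IS n)"
  show "f \<otimes>\<^bsub>IS n\<^esub> g \<in> carrier (IS n)" if "g \<in> carrier (IS n)"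
    using map_comp_carrier_IS[OF f that] by (simp add: IS_def)
  show "f \<otimes>\<^bsub>IS n\<^esub> g \<otimes>\<^bsub>IS n\<^esub> h = f \<otimes>\<^bsub>IS n\<^esub> (g \<otimes>\<^bsub>IS n\<^esub> h)"
    by (auto simp: IS_def map_comp_def split: option.splits)
  show "\<one>\<^bsub>IS n\<^esub> \<otimes>\<^bsub>IS n\<^esub> f = f"
    using f by (auto simp: IS_def map_comp_def restrict_map_def ran_def fun_eq_iff
      split: option.splits)
  show "f \<otimes>\<^bsub>IS n\<^esub> \<one>\<^bsub>IS n\<^esub> = f"
  proof
    fix x
    have "x \<notin> {1..n} \<Longrightarrow> f x = None"
      using f by (auto simp: IS_def)
    then show "(f \<otimes>\<^bsub>IS n\<^esub> \<one>\<^bsub>IS n\<^esub>) x = f x"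
      by (cases "x \<in> {1..n}") (simp_all add: IS_def map_comp_def)
  qed
next
  show "\<one>\<^bsub>IS n\<^esub> \<in> carrier (IS n)"
    by (auto simp: IS_def restrict_map_def ran_def dom_def inj_on_def split: if_splits)
qed

lemma submonoid_IS_tilde: "submonoid (IS_tilde n) (IS n)"
proof
  show "IS_tilde n \<subseteq> carrier (IS n)"
    by (auto simp: IS_tilde_def)
  have "dom (\<one>\<^bsub>IS n\<^esub>) = {1..n}"
    by (auto simp: IS_def)
  then show "\<one>\<^bsub>IS n\<^esub> \<in> IS_tilde n"
    using monoid.one_closed[OF monoid_IS] by (simp add: IS_tilde_def rank_def)
  fix f g assume fg: "f \<in> IS_tilde n" "g \<in> IS_tilde n"
  let ?D = "dom (f \<circ>\<^sub>m g)"
  have c: "f \<in> carrier (IS n)" "g \<in> carrier (IS n)"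
    using fg by (auto simp: IS_tilde_def)
  then have sub: "dom f \<subseteq> {1..n}" "dom g \<subseteq> {1..n}" "ran g \<subseteq> {1..n}" "inj_on g (dom g)"
    by (auto simp: IS_def)
  have full: "dom h = {1..n}" if "h \<in> IS_tilde n" "card ?D + 1 = n" "card ?D \<le> card (dom h)" for h
  proof -
    have "dom h \<subseteq> {1..n}"
      using that(1) by (simp add: IS_tilde_def IS_def)
    moreover have "card (dom h) \<le> n"
      using card_mono[OF _ calculation] by simp
    then have "card (dom h) = card {1..n}"
      using that by (simp add: IS_tilde_def rank_def)
    ultimately show ?thesis
      by (intro card_subset_eq) auto
  qed
  have "card ?D + 1 \<noteq> n"
  proof
    assume eq: "card ?D + 1 = n"
    have Dg: "?D \<subseteq> dom g"
      by (auto simp: map_comp_def split: option.splits)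
    have "card ?D \<le> card (dom g)"
      using Dg finite_subset[OF sub(2)] by (intro card_mono) auto
    then have dg: "dom g = {1..n}"
      using full[OF fg(2) eq] by simp
    have "(the \<circ> g) ` ?D \<subseteq> dom f"
      by (auto simp: map_comp_def split: option.splits)
    moreover have "inj_on (the \<circ> g) ?D"
    proof (rule inj_onI)
      fix x y assume "x \<in> ?D" "y \<in> ?D" "(the \<circ> g) x = (the \<circ> g) y"
      moreover have "x \<in> dom g" "y \<in> dom g"
        using calculation Dg by auto
      ultimately show "x = y"
        using sub(4) by (metis comp_apply domIff inj_on_def option.expand)
    qed
    ultimately have "card ?D \<le> card (dom f)"
      using finite_subset[OF sub(1)] card_inj_on_le by blast
    then have df: "dom f = {1..n}"
      using full[OF fg(1) eq] by simp
    have "dom g \<subseteq> ?D"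
    proof
      fix x assume "x \<in> dom g"
      then obtain y where y: "g x = Some y" by auto
      then have "y \<in> dom f"
        using sub(3) df by (auto simp: ran_def)
      then show "x \<in> ?D"
        using y by auto
    qed
    then have "?D = {1..n}"
      using Dg dg by simp
    then show False
      using eq by simp
  qed
  then show "f \<otimes>\<^bsub>IS n\<^esub> g \<in> IS_tilde n"
    using map_comp_carrier_IS[OF c] by (simp add: IS_tilde_def rank_def IS_def)
qed

end

theory Submission
  imports Defs "HOL-Combinatorics.Permutations"
begin

text \<open>
  A homomorphism out of a monoid given by generators and relations is the same thing as an
  assignment of values to the generators under which the two sides of each relation get equal
  products (\<open>presented_monoid_lift\<close>, \<open>monoid_hom_word_class\<close>). The values prescribed here only leave
  \<open>\<sigma>\<^sub>i\<inverse>\<close> open, and a homomorphism must send it to the inverse of \<open>s\<^sub>i\<close>, which is \<open>s\<^sub>i\<close> itself. So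
  existence and uniqueness of \<open>\<phi>\<close> amount to checking the relations among the \<open>s\<^sub>i\<close> and the
  \<open>\<epsilon>\<^bsub>{i,i+1}\<^esub>\<close> (\<open>letter_value_relations\<close>).

  The values of the generators have rank \<open>n\<close> and \<open>n - 2\<close>, and the elements of rank different from
  \<open>n - 1\<close> form a submonoid, so the image lies in it. Conversely, a submonoid
  that contains these values contains everything of rank different from \<open>n - 1\<close>
  (\<open>IS_tilde_generated\<close>). Conjugating by adjacent transpositions gives it all transpositions
  and all \<open>\<epsilon>\<^bsub>{a,b}\<^esub>\<close>. The former generate the symmetric group. For the latter,
  \<open>\<epsilon>\<^sub>Y \<epsilon>\<^sub>Z = \<epsilon>\<^bsub>Y \<union> Z\<^esub>\<close>, and every finite set \<open>Y\<close> with at least two elements is a union of pairs, so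
  all \<open>\<epsilon>\<^sub>Y\<close> with \<open>|Y| \<noteq> 1\<close> are obtained, the identity being the case of empty
  \<open>Y\<close>. Finally, a partial bijection with domain \<open>D\<close> extends to a permutation \<open>p\<close>, hence equals \<open>p \<epsilon>\<^sub>Y\<close> for the complement \<open>Y\<close> of \<open>D\<close>, and \<open>|Y| \<noteq> 1\<close> says exactly
  that its rank is not \<open>n - 1\<close>.
\<close>

section \<open>Homomorphisms out of a presented monoid\<close>

definition word_value :: "('b, 'c) monoid_scheme \<Rightarrow> ('a \<Rightarrow> 'b) \<Rightarrow> 'a list \<Rightarrow> 'b" where
  "word_value M f w = foldr (\<lambda>a x. f a \<otimes>\<^bsub>M\<^esub> x) w \<one>\<^bsub>M\<^esub>"

lemma word_value_simps [simp]:
  "word_value M f [] = \<one>\<^bsub>M\<^esub>"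
  "word_value M f (a # w) = f a \<otimes>\<^bsub>M\<^esub> word_value M f w"
  by (simp_all add: word_value_def)

lemma word_value_in_submonoid:
  assumes "submonoid H M" "w \<in> lists A" "\<And>a. a \<in> A \<Longrightarrow> f a \<in> H"
  shows "word_value M f w \<in> H"
  using assms(2)
  by induction (auto simp: assms(3) submonoid.one_closed[OF assms(1)]
      intro: submonoid.m_closed[OF assms(1)])

lemma word_value_closed:
  assumes "monoid M" "w \<in> lists A" "f \<in> A \<rightarrow> carrier M"
  shows "word_value M f w \<in> carrier M"
proof -
  interpret monoid M by fact
  show ?thesis
    using assms(2,3) by induction auto
qed

lemma word_value_append:
  assumes "monoid M" "u \<in> lists A" "v \<in> lists A" "f \<in> A \<rightarrow> carrier M"
  shows "word_value M f (u @ v) = word_value M f u \<otimes>\<^bsub>M\<^esub> word_value M f v"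
proof -
  interpret monoid M by fact
  note closed = word_value_closed[OF \<open>monoid M\<close> _ assms(4)]
  show ?thesis
    using assms(2)
  proof induction
    case Nil
    show ?case using closed[OF assms(3)] by simp
  next
    case (Cons a u)
    then have "f a \<in> carrier M"
      using assms(4) by blast
    then show ?case
      using Cons closed[OF assms(3)] closed[OF Cons.hyps(2)] by (simp add: m_assoc)
  qed
qed

lemma word_value_monoid_cong:
  assumes "monoid M" "f \<in> A \<rightarrow> carrier M"
    and R: "\<And>u v. (u, v) \<in> R \<Longrightarrow> word_value M f u = word_value M f v"
    and "(u, v) \<in> monoid_cong A R"
  shows "word_value M f u = word_value M f v"
  using assms(4)
proof induction
  case (mult u v u' v')
  then show ?case
    using monoid_cong_lists[OF mult.hyps(1)] monoid_cong_lists[OF mult.hyps(2)]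
    by (simp add: word_value_append[OF assms(1) _ _ assms(2)])
qed (auto dest: R)

lemma presented_monoid_lift:
  assumes M: "monoid M" and f: "f \<in> A \<rightarrow> carrier M"
    and R: "\<And>u v. (u, v) \<in> R \<Longrightarrow> word_value M f u = word_value M f v"
  obtains h where "h \<in> monoid_hom (presented_monoid A R) M"
    "\<And>w. w \<in> lists A \<Longrightarrow> h (word_class A R w) = word_value M f w"
proof
  define h where "h X = word_value M f (SOME w. w \<in> X)" for X
  show h: "h (word_class A R w) = word_value M f w" if "w \<in> lists A" for w
  proof -
    have "w \<in> word_class A R w"
      using that by (auto simp: word_class_def intro: monoid_cong.refl)
    then have "(SOME v. v \<in> word_class A R w) \<in> word_class A R w"
      by (rule someI)
    then have "(w, SOME v. v \<in> word_class A R w) \<in> monoid_cong A R"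
      by (simp add: word_class_def)
    from word_value_monoid_cong[OF M f R this] show ?thesis
      by (simp add: h_def)
  qed
  have "h \<in> hom (presented_monoid A R) M"
    by (intro homI, unfold carrier_presented_monoid)
      (elim imageE, simp only: h mult_presented_monoid append_in_lists_conv
        word_value_closed[OF M _ f] word_value_append[OF M _ _ f])+
  then show "h \<in> monoid_hom (presented_monoid A R) M"
    by (simp add: monoid_hom_def one_presented_monoid h)
qed

lemma monoid_hom_word_class:
  assumes h: "h \<in> monoid_hom (presented_monoid A R) M" and "w \<in> lists A"
  shows "h (word_class A R w) = word_value M (\<lambda>a. h (word_class A R [a])) w"
  using assms(2)
proof induction
  case Nil
  show ?case
    using h by (simp add: monoid_hom_def one_presented_monoid)
next
  case (Cons a w)
  then have "word_class A R (a # w)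
      = word_class A R [a] \<otimes>\<^bsub>presented_monoid A R\<^esub> word_class A R w"
    by (simp add: mult_presented_monoid)
  moreover have "word_class A R [a] \<in> carrier (presented_monoid A R)"
    "word_class A R w \<in> carrier (presented_monoid A R)"
    using Cons.hyps unfolding carrier_presented_monoid by auto
  ultimately show ?case
    using h Cons.IH hom_mult[of h "presented_monoid A R" M]
    by (simp add: monoid_hom_def)
qed

lemma submonoid_image_monoid_hom:
  assumes "monoid G" "monoid M" "h \<in> monoid_hom G M"
  shows "submonoid (h ` carrier G) M"
proof
  interpret G: monoid G by fact
  have hom: "h \<in> hom G M" "h \<one>\<^bsub>G\<^esub> = \<one>\<^bsub>M\<^esub>"
    using assms(3) by (auto simp: monoid_hom_def)
  show "h ` carrier G \<subseteq> carrier M"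
    using hom(1) by (auto simp: hom_def)
  show "\<one>\<^bsub>M\<^esub> \<in> h ` carrier G"
    using hom(2) G.one_closed by (metis imageI)
  fix x y assume "x \<in> h ` carrier G" "y \<in> h ` carrier G"
  then show "x \<otimes>\<^bsub>M\<^esub> y \<in> h ` carrier G"
    using hom_mult[OF hom(1)] G.m_closed by (auto simp: image_iff) (metis G.m_closed)
qed

section \<open>Restrictions of total maps\<close>

text \<open>In this form a product of partial maps is a composition of total maps together with an
  intersection of sets, so an identity in the symmetric inverse monoid splits into an equality of
  domains and an equality of total maps on the common domain.\<close>

definition map_on :: "(nat \<Rightarrow> nat) \<Rightarrow> nat set \<Rightarrow> (nat \<rightharpoonup> nat)" where
  "map_on p A = (Some \<circ> p) |` A"

lemma simple_transp_eq: "simple_transp n i = map_on (transpose i (i + 1)) {1..n}"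
  by (simp add: simple_transp_def map_on_def)

lemma eps_eq: "eps n Y = map_on id ({1..n} - Y)"
  by (simp add: eps_def map_on_def)

lemma one_IS: "\<one>\<^bsub>IS n\<^esub> = map_on id {1..n}"
  by (simp add: IS_def map_on_def)

lemma mult_IS: "f \<otimes>\<^bsub>IS n\<^esub> g = f \<circ>\<^sub>m g"
  by (simp add: IS_def)

lemma map_on_comp: "map_on p A \<circ>\<^sub>m map_on q B = map_on (p \<circ> q) (B \<inter> q -` A)"
  by (auto simp: map_on_def map_comp_def restrict_map_def fun_eq_iff)

lemma map_on_cong: "A = B \<Longrightarrow> (\<And>x. x \<in> B \<Longrightarrow> p x = q x) \<Longrightarrow> map_on p A = map_on q B"
  by (auto simp: map_on_def restrict_map_def fun_eq_iff)

lemma dom_map_on [simp]: "dom (map_on p A) = A"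
  by (auto simp: map_on_def restrict_map_def dom_def)

lemma map_on_carrier_IS:
  assumes "p permutes {1..n}" "A \<subseteq> {1..n}"
  shows "map_on p A \<in> carrier (IS n)"
proof -
  have "ran (map_on p A) \<subseteq> p ` A"
    by (auto simp: map_on_def restrict_map_def ran_def split: if_splits)
  also have "\<dots> \<subseteq> {1..n}"
    using assms permutes_image[OF assms(1)] by blast
  finally have "ran (map_on p A) \<subseteq> {1..n}" .
  moreover have "inj_on (map_on p A) A"
    using permutes_inj[OF assms(1)] by (auto simp: map_on_def inj_on_def)
  ultimately show ?thesis
    using assms(2) by (simp add: IS_def)
qed

lemma map_on_in_IS_tilde:
  assumes "p permutes {1..n}" "A \<subseteq> {1..n}" "card A + 1 \<noteq> n"
  shows "map_on p A \<in> IS_tilde n"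
  using assms map_on_carrier_IS by (simp add: IS_tilde_def rank_def)

lemma permutes_transpose_adjacent:
  fixes i n :: nat
  shows "i \<in> {1..<n} \<Longrightarrow> transpose i (i + 1) permutes {1..n}"
  by (rule permutes_swap_id) auto

text \<open>The complements of the domain and of the range have equally many elements, so a bijection
  between them completes the partial bijection to a permutation.\<close>

lemma IS_extends_to_permutation:
  assumes "f \<in> carrier (IS n)"
  obtains p where "p permutes {1..n}" "f = map_on p (dom f)"
proof -
  let ?D = "dom f" and ?g = "the \<circ> f"
  have f: "?D \<subseteq> {1..n}" "ran f \<subseteq> {1..n}" "inj_on f ?D"
    using assms by (auto simp: IS_def)
  have inj: "inj_on ?g ?D"
    using f(3) by (auto simp: inj_on_def dom_def)
  have img: "?g ` ?D \<subseteq> {1..n}"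
    using f(2) by (auto simp: ran_def)
  have "card (?g ` ?D) = card ?D"
    by (rule card_image[OF inj])
  then have "card ({1..n} - ?D) = card ({1..n} - ?g ` ?D)"
    using f(1) img finite_subset[OF f(1)] finite_subset[OF img] by (simp add: card_Diff_subset)
  then obtain r where r: "bij_betw r ({1..n} - ?D) ({1..n} - ?g ` ?D)"
    using finite_same_card_bij[of "{1..n} - ?D" "{1..n} - ?g ` ?D"] by auto
  define p where "p x = (if x \<in> ?D then ?g x else if x \<in> {1..n} then r x else x)" for x
  have "bij_betw p ?D (?g ` ?D)"
    using inj by (auto simp: p_def bij_betw_def inj_on_def)
  moreover have "bij_betw p ({1..n} - ?D) ({1..n} - ?g ` ?D)"
    using r by (rule bij_betw_cong[THEN iffD1, rotated]) (simp add: p_def)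
  ultimately have "bij_betw p (?D \<union> ({1..n} - ?D)) (?g ` ?D \<union> ({1..n} - ?g ` ?D))"
    by (rule bij_betw_combine) blast
  then have "bij_betw p {1..n} {1..n}"
    using f(1) img by (simp add: Un_absorb1)
  then have "p permutes {1..n}"
    using f(1) by (intro bij_imp_permutes) (auto simp: p_def)
  moreover have "f = map_on p ?D"
    by (auto simp: fun_eq_iff map_on_def restrict_map_def p_def domIff)
  ultimately show thesis
    by (rule that)
qed

section \<open>The values of the generators\<close>

fun letter_value :: "nat \<Rightarrow> sb_letter \<Rightarrow> (nat \<rightharpoonup> nat)" where
  "letter_value n (Sig i) = simple_transp n i"
| "letter_value n (SigInv i) = simple_transp n i"
| "letter_value n (Tau i) = eps n {i, i + 1}"

lemma letter_value_IS_tilde: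
  assumes "a \<in> sb_letters n"
  shows "letter_value n a \<in> IS_tilde n"
proof -
  have "simple_transp n i \<in> IS_tilde n" if "i \<in> {1..<n}" for i
    using map_on_in_IS_tilde[OF permutes_transpose_adjacent[OF that]] that
    by (auto simp: simple_transp_eq)
  moreover have "eps n {i, i + 1} \<in> IS_tilde n" if "i \<in> {1..<n}" for i
  proof -
    have "card ({1..n} - {i, i + 1}) = n - 2"
      using that by (subst card_Diff_subset) auto
    then show ?thesis
      using that by (auto simp: eps_eq intro!: map_on_in_IS_tilde permutes_id)
  qed
  ultimately show ?thesis
    using assms by (auto simp: sb_letters_def)
qed

lemma simple_transp_involution:
  assumes "i \<in> {1..<n}"
  shows "simple_transp n i \<otimes>\<^bsub>IS n\<^esub> simple_transp n i = \<one>\<^bsub>IS n\<^esub>"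
  using assms unfolding mult_IS simple_transp_eq one_IS map_on_comp
  by (intro map_on_cong) (auto simp: transpose_def)

text \<open>With the right factor applied first, the product \<open>s\<^sub>j s\<^sub>i\<close> carries \<open>{j, j + 1}\<close> onto
  \<open>{i, i + 1}\<close> when \<open>i\<close> and \<open>j\<close> are adjacent, which gives the mixed braid relation. The relations
  in which \<open>\<tau>\<^sub>i\<close> commutes with some \<open>\<sigma>\<^sub>j\<close> hold because \<open>s\<^sub>j\<close> then maps \<open>{i, i + 1}\<close> to itself.\<close>

lemma letter_value_relations:
  assumes "(u, v) \<in> sb_relations n"
  shows "word_value (IS n) (letter_value n) u = word_value (IS n) (letter_value n) v"
  using assms
proof cases
  case (braid i j)
  then have "j = i + 1 \<or> i = j + 1" by auto
  then show ?thesis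
    using braid unfolding braid
    by (auto simp: mult_IS simple_transp_eq one_IS map_on_comp transpose_def intro!: map_on_cong)
next
  case (mixed_braid i j)
  then have "j = i + 1 \<or> i = j + 1" by auto
  then show ?thesis
    using mixed_braid unfolding mixed_braid
    by (auto simp: mult_IS simple_transp_eq eps_eq one_IS map_on_comp transpose_def
        intro!: map_on_cong split: if_splits)
qed (auto simp: mult_IS simple_transp_eq eps_eq one_IS map_on_comp transpose_def
        intro!: map_on_cong split: if_splits)

section \<open>Generation of the elements of rank different from n - 1\<close>

text \<open>Conjugation by \<open>s\<^sub>b\<close> replaces \<open>b\<close> by \<open>b + 1\<close> both in a transposition and in a removed pair, so
  all transpositions and all pairs are reached from adjacent ones.\<close>

lemma conjugate_map_on_transpose:
  assumes "1 \<le> a" "a < b" "b < n"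
  shows "simple_transp n b \<circ>\<^sub>m map_on (transpose a b) {1..n} \<circ>\<^sub>m simple_transp n b
    = map_on (transpose a (Suc b)) {1..n}"
  using assms unfolding simple_transp_eq map_on_comp
  by (intro map_on_cong) (auto simp: transpose_def split: if_splits)

lemma conjugate_eps_pair:
  assumes "1 \<le> a" "a < b" "b < n"
  shows "simple_transp n b \<circ>\<^sub>m eps n {a, b} \<circ>\<^sub>m simple_transp n b = eps n {a, Suc b}"
  using assms unfolding simple_transp_eq eps_eq map_on_comp
  by (intro map_on_cong) (auto simp: transpose_def split: if_splits)

lemma eps_union: "eps n Y \<circ>\<^sub>m eps n Z = eps n (Y \<union> Z)"
  unfolding eps_eq map_on_comp by (intro map_on_cong) auto

lemma IS_tilde_generated:
  assumes T: "submonoid T (IS n)"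
    and s: "\<And>i. i \<in> {1..<n} \<Longrightarrow> simple_transp n i \<in> T"
    and e: "\<And>i. i \<in> {1..<n} \<Longrightarrow> eps n {i, i + 1} \<in> T"
  shows "IS_tilde n \<subseteq> T"
proof
  have mult: "f \<circ>\<^sub>m g \<in> T" if "f \<in> T" "g \<in> T" for f g
    using submonoid.m_closed[OF T that] by (simp add: mult_IS)
  have one: "map_on id {1..n} \<in> T"
    using submonoid.one_closed[OF T] by (simp add: one_IS)
  have pair_ordered: "b \<le> n \<Longrightarrow> map_on (transpose a b) {1..n} \<in> T \<and> eps n {a, b} \<in> T"
    if "Suc a \<le> b" "1 \<le> a" for a b
    using that(1)
  proof (induction rule: dec_induct)
    case base
    then show ?case
      using s[of a] e[of a] that(2) by (simp add: simple_transp_eq)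
  next
    case (step b)
    then have "simple_transp n b \<in> T" "map_on (transpose a b) {1..n} \<in> T" "eps n {a, b} \<in> T"
      using s[of b] that(2) by auto
    then show ?case
      using conjugate_map_on_transpose[of a b n] conjugate_eps_pair[of a b n] step that(2)
      by (metis Suc_le_eq mult)
  qed
  have pair: "map_on (transpose a b) {1..n} \<in> T \<and> eps n {a, b} \<in> T"
    if "a \<in> {1..n}" "b \<in> {1..n}" "a \<noteq> b" for a b
    using pair_ordered[of a b] pair_ordered[of b a] that
    by (cases "a < b") (auto simp: transpose_commute insert_commute)
  have perm: "map_on p {1..n} \<in> T" if "p permutes {1..n}" for p
    using that finite_atLeastAtMost
  proof (induction rule: permutes_induct)
    case id
    show ?case by (rule one)
  next
    case (swap a b p)
    have "map_on (transpose a b) {1..n} \<circ>\<^sub>m map_on p {1..n} = map_on (transpose a b \<circ> p) {1..n}"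
      unfolding map_on_comp using permutes_image[OF swap.hyps(4)]
      by (intro map_on_cong) auto
    then show ?case
      using mult pair[OF swap.hyps(1-3)] swap.IH by metis
  qed
  \<comment> \<open>A set containing \<open>a\<close> is assembled from the pairs that join \<open>a\<close> to its other elements.\<close>
  have eps_insert: "insert a Z \<subseteq> {1..n} \<Longrightarrow> a \<notin> Z \<Longrightarrow> eps n (insert a Z) \<in> T"
    if "finite Z" "Z \<noteq> {}" for a Z
    using that
  proof (induction rule: finite_ne_induct)
    case (singleton b)
    then show ?case using pair[of a b] by auto
  next
    case (insert b Z)
    have "eps n {a, b} \<circ>\<^sub>m eps n (insert a Z) = eps n (insert a (insert b Z))"
      unfolding eps_union by (rule arg_cong[of _ _ "eps n"]) auto
    moreover have "eps n {a, b} \<in> T" "eps n (insert a Z) \<in> T"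
      using insert pair[of a b] by auto
    ultimately show ?case
      using mult by metis
  qed
  have eps: "eps n Y \<in> T" if Y: "Y \<subseteq> {1..n}" "card Y \<noteq> 1" for Y
  proof (cases "Y = {}")
    case True
    then show ?thesis using one by (simp add: eps_eq)
  next
    case False
    then obtain a where a: "a \<in> Y" by blast
    have "Y - {a} \<noteq> {}"
    proof
      assume "Y - {a} = {}"
      then have "Y = {a}" using a by blast
      then show False using Y(2) by simp
    qed
    moreover have "finite (Y - {a})"
      using finite_subset[OF Y(1)] by simp
    ultimately have "eps n (insert a (Y - {a})) \<in> T"
      using a Y(1) by (intro eps_insert) auto
    then show ?thesis
      using a by (simp add: insert_absorb)
  qed
  fix f assume f: "f \<in> IS_tilde n"
  then obtain p where p: "p permutes {1..n}" "f = map_on p (dom f)"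
    using IS_extends_to_permutation by (auto simp: IS_tilde_def)
  let ?Y = "{1..n} - dom f"
  have D: "dom f \<subseteq> {1..n}" "card (dom f) + 1 \<noteq> n"
    using f by (auto simp: IS_tilde_def IS_def rank_def)
  have "card ?Y + card (dom f) = n"
    using D(1) card_mono[OF _ D(1)] finite_subset[OF D(1)] by (simp add: card_Diff_subset)
  then have "card ?Y \<noteq> 1"
    using D(2) by linarith
  then have "map_on p {1..n} \<circ>\<^sub>m eps n ?Y \<in> T"
    by (intro mult perm eps p) auto
  also have "map_on p {1..n} \<circ>\<^sub>m eps n ?Y = map_on p (dom f)"
    unfolding eps_eq map_on_comp using D(1) by (intro map_on_cong) auto
  finally show "f \<in> T"
    using p(2) by simp
qed

section \<open>The homomorphism and its image\<close>

text \<open>Only the inverse generators need an argument: the image of \<open>\<sigma>\<^sub>i\<inverse>\<close> is a left inverse of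
  \<open>s\<^sub>i\<close>, and \<open>s\<^sub>i\<close> is its own right inverse, so the two coincide.\<close>

lemma monoid_hom_SB_letter:
  assumes \<psi>: "\<psi> \<in> monoid_hom (SB n) (IS n)"
    and gen: "\<forall>i\<in>{1..<n}. \<psi> (sigma n i) = simple_transp n i \<and> \<psi> (tau n i) = eps n {i, i + 1}"
    and a: "a \<in> sb_letters n"
  shows "\<psi> (word_class (sb_letters n) (sb_relations n) [a]) = letter_value n a"
proof (cases a)
  case (SigInv i)
  let ?A = "sb_letters n" and ?R = "sb_relations n"
  let ?x = "word_class ?A ?R [SigInv i]"
  have i: "i \<in> {1..<n}"
    using a SigInv by (auto simp: sb_letters_def)
  then have l: "[Sig i] \<in> lists ?A" "[SigInv i] \<in> lists ?A"
    by (auto simp: sb_letters_def)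
  have "([SigInv i, Sig i], []) \<in> monoid_cong ?A ?R"
    using i l by (intro monoid_cong.base sb_relations.inv_left) auto
  then have "?x \<otimes>\<^bsub>SB n\<^esub> sigma n i = \<one>\<^bsub>SB n\<^esub>"
    using l by (simp add: SB_def sigma_def mult_presented_monoid one_presented_monoid
        word_class_eq_iff)
  moreover have mem: "?x \<in> carrier (SB n)" "sigma n i \<in> carrier (SB n)"
    using l unfolding SB_def sigma_def carrier_presented_monoid by blast+
  ultimately have "\<psi> ?x \<otimes>\<^bsub>IS n\<^esub> simple_transp n i = \<one>\<^bsub>IS n\<^esub>"
    using \<psi> gen i hom_mult[of \<psi> "SB n" "IS n" ?x "sigma n i"] by (simp add: monoid_hom_def)
  moreover have "\<psi> ?x \<in> carrier (IS n)" "simple_transp n i \<in> carrier (IS n)"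
    using \<psi> mem gen i by (auto simp: monoid_hom_def dest: hom_in_carrier)
  ultimately have "\<psi> ?x = simple_transp n i"
    using monoid.inv_unique[OF monoid_IS _ simple_transp_involution[OF i]] by blast
  then show ?thesis
    using SigInv by simp
qed (use gen a in \<open>auto simp: sigma_def tau_def sb_letters_def\<close>)

theorem proposition16:
  fixes n :: nat
  assumes "n \<ge> 1"
  shows "\<exists>\<phi>. \<phi> \<in> monoid_hom (SB n) (IS n)
    \<and> (\<forall>i\<in>{1..<n}. \<phi> (sigma n i) = simple_transp n i \<and> \<phi> (tau n i) = eps n {i, i + 1})
    \<and> (\<forall>\<psi>\<in>monoid_hom (SB n) (IS n).
          (\<forall>i\<in>{1..<n}. \<psi> (sigma n i) = simple_transp n i \<and> \<psi> (tau n i) = eps n {i, i + 1})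
          \<longrightarrow> (\<forall>x\<in>carrier (SB n). \<psi> x = \<phi> x))
    \<and> \<phi> ` carrier (SB n) = IS_tilde n"
proof -
  let ?A = "sb_letters n" and ?R = "sb_relations n"
  let ?value = "word_value (IS n) (letter_value n)"
  have lv: "letter_value n \<in> ?A \<rightarrow> carrier (IS n)"
    using letter_value_IS_tilde by (auto simp: IS_tilde_def)
  obtain \<phi> where \<phi>: "\<phi> \<in> monoid_hom (SB n) (IS n)"
    and \<phi>_word: "\<And>w. w \<in> lists ?A \<Longrightarrow> \<phi> (word_class ?A ?R w) = ?value w"
    using presented_monoid_lift[OF monoid_IS lv letter_value_relations] unfolding SB_def by blast
  have \<phi>_letter: "\<phi> (word_class ?A ?R [a]) = letter_value n a" if a: "a \<in> ?A" for a
    using \<phi>_word[of "[a]"] a lv monoid.r_one[OF monoid_IS] by auto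
  have gen: "\<forall>i\<in>{1..<n}. \<phi> (sigma n i) = simple_transp n i \<and> \<phi> (tau n i) = eps n {i, i + 1}"
    using \<phi>_letter by (auto simp: sigma_def tau_def sb_letters_def)
  have unique: "\<psi> x = \<phi> x"
    if \<psi>: "\<psi> \<in> monoid_hom (SB n) (IS n)"
      "\<forall>i\<in>{1..<n}. \<psi> (sigma n i) = simple_transp n i \<and> \<psi> (tau n i) = eps n {i, i + 1}"
      and "x \<in> carrier (SB n)" for \<psi> x
  proof -
    obtain w where w: "w \<in> lists ?A" "x = word_class ?A ?R w"
      using \<open>x \<in> carrier (SB n)\<close> unfolding SB_def carrier_presented_monoid by blast
    have "\<psi> x = word_value (IS n) (\<lambda>a. \<psi> (word_class ?A ?R [a])) w"
      using monoid_hom_word_class[OF \<psi>(1)[unfolded SB_def] w(1)] w(2) by simp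
    also have "\<dots> = ?value w"
      using w(1) by induction (simp_all add: monoid_hom_SB_letter[OF \<psi>])
    also have "\<dots> = \<phi> x"
      using \<phi>_word w by simp
    finally show ?thesis .
  qed
  have "\<phi> ` carrier (SB n) \<subseteq> IS_tilde n"
    unfolding SB_def carrier_presented_monoid image_image
  proof (rule image_subsetI)
    fix w assume w: "w \<in> lists ?A"
    then show "\<phi> (word_class ?A ?R w) \<in> IS_tilde n"
      unfolding \<phi>_word[OF w]
      by (rule word_value_in_submonoid[OF submonoid_IS_tilde]) (rule letter_value_IS_tilde)
  qed
  moreover have "IS_tilde n \<subseteq> \<phi> ` carrier (SB n)"
  proof (rule IS_tilde_generated)
    show "submonoid (\<phi> ` carrier (SB n)) (IS n)"
      by (rule submonoid_image_monoid_hom[OF monoid_SB monoid_IS \<phi>])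
    fix i assume i: "i \<in> {1..<n}"
    have "sigma n i \<in> carrier (SB n)"
      using sigma_Units[OF i] by (simp add: Units_def)
    then show "simple_transp n i \<in> \<phi> ` carrier (SB n)"
      using gen i by (metis imageI)
    show "eps n {i, i + 1} \<in> \<phi> ` carrier (SB n)"
      using gen i tau_carrier[OF i] by (metis imageI)
  qed
  ultimately show ?thesis
    using \<phi> gen unique by blast
qed

end
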